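(* For each positive integer $m$, let $K_{2m,2m,2m}$ be the complete tripartite graph with three partition classes of $2m$ vertices each, and let $M=M_m$ be any given perfect matching in $K_{2m,2m,2m}$. Then $$\lim_{m\to\infty}\frac{\mathrm{pm}(K_{2m,2m,2m}-M)}{\mathrm{pm}(K_{2m,2m,2m})}=e^{-3/4}.$$
   Context: Graphs are finite and simple, with labelled vertices. For a graph $G$, $\mathrm{pm}(G)$ denotes the number of perfect matchings of $G$. For a set $M$ of edges of $G$, $G-M$ is the graph with the same vertex set as $G$ and edge set $E(G)\setminus M$. The complete tripartite graph has as its edges exactly all pairs of vertices lying in different partition classes. Since $M$ may depend on $m$, the limit is asserted for every choice of a sequence $(M_m)_{m\ge 1}$ of perfect matchings, $M_m$ in $K_{2m,2m,2m}$. *)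

theory Defs
  imports Complex_Main
begin

(* A graph is a pair (V, E) of vertices and edges. The type does not enforce that edges are
   two-element subsets of V; this is the predicate finite_simple_graph below. *)
type_synonym 'a ugraph = "'a set \<times> 'a set set"

definition finite_simple_graph :: "'a ugraph \<Rightarrow> bool" where
  "finite_simple_graph G \<longleftrightarrow> finite (fst G) \<and> (\<forall>e \<in> snd G. e \<subseteq> fst G \<and> card e = 2)"

definition delete_edges :: "'a ugraph \<Rightarrow> 'a set set \<Rightarrow> 'a ugraph" where
  "delete_edges G M = (fst G, snd G - M)"

definition perfect_matching :: "'a ugraph \<Rightarrow> 'a set set \<Rightarrow> bool" where
  "perfect_matching G M \<longleftrightarrow> M \<subseteq> snd G \<and> (\<forall>v \<in> fst G. \<exists>!e. e \<in> M \<and> v \<in> e)"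

(* Perfect matchings are counted as edge sets, that is, vertices are labelled. *)
definition pm :: "'a ugraph \<Rightarrow> nat" where
  "pm G = card {M. perfect_matching G M}"

(* The vertex (i, k) is the k-th vertex of the partition class i, where i = 0, 1, 2. *)
definition tripartite_verts :: "nat \<Rightarrow> nat \<Rightarrow> nat \<Rightarrow> (nat \<times> nat) set" where
  "tripartite_verts a b c = {0} \<times> {..<a} \<union> {1} \<times> {..<b} \<union> {2} \<times> {..<c}"

definition complete_tripartite :: "nat \<Rightarrow> nat \<Rightarrow> nat \<Rightarrow> (nat \<times> nat) ugraph" where
  "complete_tripartite a b c =
     (tripartite_verts a b c,
      {{u, v} | u v. u \<in> tripartite_verts a b c \<and> v \<in> tripartite_verts a b c \<and> fst u \<noteq> fst v})"

lemma finite_simple_graph_complete_tripartite: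
  "finite_simple_graph (complete_tripartite a b c)"
  by (auto simp: finite_simple_graph_def complete_tripartite_def tripartite_verts_def card_insert_if)

lemma finite_simple_graph_delete_edges:
  "finite_simple_graph G \<Longrightarrow> finite_simple_graph (delete_edges G M)"
  by (auto simp: finite_simple_graph_def delete_edges_def)

(* The set counted by pm is finite, so card does not take its default value 0. *)
lemma finite_perfect_matchings:
  assumes "finite_simple_graph G"
  shows "finite {M. perfect_matching G M}"
proof -
  have "snd G \<subseteq> Pow (fst G)" "finite (fst G)"
    using assms by (auto simp: finite_simple_graph_def)
  then have "finite (Pow (snd G))"
    by (meson finite_Pow_iff finite_subset)
  moreover have "{M. perfect_matching G M} \<subseteq> Pow (snd G)"
    by (auto simp: perfect_matching_def)
  ultimately show ?thesis by (rule rev_finite_subset)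
qed

end

theory Submission
  imports Defs "HOL-Analysis.Uniform_Limit"
begin

text \<open>By inclusion-exclusion over the subsets \<open>S\<close> of \<open>M\<close>, the number of perfect matchings avoiding
  \<open>M\<close> is the alternating sum of the numbers of perfect matchings containing \<open>S\<close>. The latter are
  perfect matchings of the complete tripartite graph on the vertices not covered by \<open>S\<close>; for class
  sizes \<open>x + y\<close>, \<open>x + z\<close>, \<open>y + z\<close> there are \<open>(x + y)! (x + z)! (y + z)! / (x! y! z!)\<close> of them.
  A perfect matching has exactly \<open>m\<close> edges between any two classes, so the ratio is a sum over the
  numbers \<open>i, j, k\<close> of edges of \<open>S\<close> of the three types. As \<open>m\<close> tends to infinity, the summand tends
  to \<open>(-1/4)^(i + j + k) / (i! j! k!)\<close>, and it is bounded by \<open>1 / (i! j! k!)\<close>, so Tannery's theorem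
  gives the limit \<open>exp (-1/4)^3\<close>.\<close>

subsection \<open>Perfect matchings of complete tripartite graphs\<close>

text \<open>Arbitrary vertex sets are allowed because deleting the endpoints of matching edges
  leaves a graph of the same form, so the counting can recurse on \<open>V\<close>.\<close>

definition colour_edges :: "(nat \<times> nat) set \<Rightarrow> (nat \<times> nat) set set" where
  "colour_edges V = {{u, v} | u v. u \<in> V \<and> v \<in> V \<and> fst u \<noteq> fst v}"

lemma complete_tripartite_eq:
  "complete_tripartite a b c = (tripartite_verts a b c, colour_edges (tripartite_verts a b c))"
  by (simp add: complete_tripartite_def colour_edges_def)

lemma colour_edges_Diff: "e \<in> colour_edges (V - W) \<longleftrightarrow> e \<in> colour_edges V \<and> e \<inter> W = {}"
  unfolding colour_edges_def by blast

lemma colour_edges_subset: "e \<in> colour_edges V \<Longrightarrow> e \<subseteq> V"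
  by (auto simp: colour_edges_def)

lemma colour_edges_nonempty: "e \<in> colour_edges V \<Longrightarrow> e \<noteq> {}"
  by (auto simp: colour_edges_def)

lemma finite_colour_edges: "finite V \<Longrightarrow> finite (colour_edges V)"
  by (rule finite_subset[of _ "Pow V"]) (auto dest: colour_edges_subset)

section \<open>Perfect matchings containing prescribed edges\<close>

lemma finite_perfect_matching:
  assumes "finite V" "perfect_matching (V, colour_edges V) M"
  shows "finite M"
  using assms finite_colour_edges finite_subset by (fastforce simp: perfect_matching_def)

lemma perfect_matching_disjoint:
  assumes "perfect_matching (V, colour_edges V) M"
  shows "disjoint M"
proof (rule disjointI)
  fix a b assume "a \<in> M" "b \<in> M" "a \<noteq> b"
  then show "a \<inter> b = {}"
    using assms colour_edges_subset unfolding perfect_matching_def fst_conv snd_conv by blast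
qed

lemma finite_matchings: "finite V \<Longrightarrow> finite {N. perfect_matching (V, colour_edges V) N}"
  by (rule finite_subset[of _ "Pow (colour_edges V)"])
     (auto simp: perfect_matching_def finite_colour_edges)

text \<open>The edges of \<open>N\<close> avoid \<open>\<Union>S\<close>, so a vertex in
  \<open>\<Union>S\<close> is covered by \<open>S\<close> only and any other vertex by
  \<open>N\<close> only.\<close>

lemma perfect_matching_Un:
  assumes S: "S \<subseteq> colour_edges V" "disjoint S"
    and N: "perfect_matching (V - \<Union>S, colour_edges (V - \<Union>S)) N"
  shows "perfect_matching (V, colour_edges V) (N \<union> S)"
  unfolding perfect_matching_def fst_conv snd_conv
proof (intro conjI ballI)
  have Nc: "e \<in> colour_edges V \<and> e \<inter> \<Union>S = {}" if "e \<in> N" for e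
    using N that by (auto simp: perfect_matching_def colour_edges_Diff subset_iff)
  then show "N \<union> S \<subseteq> colour_edges V" using S by auto
  fix v assume v: "v \<in> V"
  show "\<exists>!e. e \<in> N \<union> S \<and> v \<in> e"
  proof (cases "v \<in> \<Union>S")
    case True
    then obtain e where "e \<in> S" "v \<in> e" by blast
    then show ?thesis
      using Nc S(2) by (intro ex1I[of _ e]) (auto simp: disjoint_def)
  next
    case False
    then have "\<exists>!e. e \<in> N \<and> v \<in> e" using N v by (auto simp: perfect_matching_def)
    then show ?thesis using False by blast
  qed
qed

text \<open>Distinct edges of \<open>N\<close> are disjoint, so those outside \<open>S\<close> avoid
  the endpoints of \<open>S\<close> and survive in the smaller graph.\<close>

lemma perfect_matching_Diff:
  assumes S: "S \<subseteq> N" and N: "perfect_matching (V, colour_edges V) N"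
  shows "perfect_matching (V - \<Union>S, colour_edges (V - \<Union>S)) (N - S)"
  unfolding perfect_matching_def fst_conv snd_conv
proof (intro conjI ballI)
  show "N - S \<subseteq> colour_edges (V - \<Union>S)"
  proof
    fix e assume e: "e \<in> N - S"
    then have "e \<inter> f = {}" if "f \<in> S" for f
      using disjointD[OF perfect_matching_disjoint[OF N], of e f] S that by auto
    then have "e \<inter> \<Union>S = {}" by blast
    then show "e \<in> colour_edges (V - \<Union>S)"
      using e N by (auto simp: perfect_matching_def colour_edges_Diff)
  qed
  fix v assume v: "v \<in> V - \<Union>S"
  then have "\<exists>!e. e \<in> N \<and> v \<in> e" using N by (auto simp: perfect_matching_def)
  then show "\<exists>!e. e \<in> N - S \<and> v \<in> e" using v by blast
qed

lemma card_matchings_containing: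
  assumes S: "S \<subseteq> colour_edges V" "disjoint S"
  shows "card {N. perfect_matching (V, colour_edges V) N \<and> S \<subseteq> N}
         = pm (V - \<Union>S, colour_edges (V - \<Union>S))"
  unfolding pm_def
proof (rule bij_betw_same_card[of "\<lambda>N. N - S"], rule bij_betw_byWitness[where f' = "\<lambda>N. N \<union> S"])
  \<comment> \<open>Needed for \<open>N \<union> S - S = N\<close>: a common edge would be both
    contained in \<open>\<Union>S\<close> and disjoint from it, hence empty.\<close>
  have "N \<inter> S = {}" if N: "perfect_matching (V - \<Union>S, colour_edges (V - \<Union>S)) N" for N
  proof -
    have "e \<inter> \<Union>S = {} \<and> e \<noteq> {}" if "e \<in> N" for e
      using N that
      by (auto simp: perfect_matching_def colour_edges_Diff subset_iff dest: colour_edges_nonempty)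
    then show ?thesis by blast
  qed
  then show "\<forall>N\<in>{N. perfect_matching (V - \<Union>S, colour_edges (V - \<Union>S)) N}. N \<union> S - S = N"
    by auto
  show "(\<lambda>N. N \<union> S) ` {N. perfect_matching (V - \<Union>S, colour_edges (V - \<Union>S)) N}
        \<subseteq> {N. perfect_matching (V, colour_edges V) N \<and> S \<subseteq> N}"
    using perfect_matching_Un[OF S] by auto
  show "(\<lambda>N. N - S) ` {N. perfect_matching (V, colour_edges V) N \<and> S \<subseteq> N}
        \<subseteq> {N. perfect_matching (V - \<Union>S, colour_edges (V - \<Union>S)) N}"
    using perfect_matching_Diff by auto
qed auto

text \<open>The partner \<open>u\<close> of \<open>v\<close> is unique, so the matchings split
  according to it; those containing \<open>{v, u}\<close> correspond to the matchings of what is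
  left.\<close>

lemma pm_match_vertex:
  assumes "finite V" "v \<in> V"
  shows "pm (V, colour_edges V)
         = (\<Sum>u | u \<in> V \<and> fst u \<noteq> fst v. pm (V - {v, u}, colour_edges (V - {v, u})))"
proof -
  let ?U = "{u \<in> V. fst u \<noteq> fst v}"
  let ?P = "\<lambda>u. {N. perfect_matching (V, colour_edges V) N \<and> {{v, u}} \<subseteq> N}"
  have "{N. perfect_matching (V, colour_edges V) N} = (\<Union>u\<in>?U. ?P u)"
  proof (intro equalityI subsetI)
    fix N assume "N \<in> {N. perfect_matching (V, colour_edges V) N}"
    then have N: "perfect_matching (V, colour_edges V) N" by simp
    then obtain e where e: "e \<in> N" "v \<in> e" "e \<in> colour_edges V"
      using assms(2) unfolding perfect_matching_def fst_conv snd_conv by blast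
    then obtain u where "e = {v, u}" "u \<in> ?U" by (auto simp: colour_edges_def doubleton_eq_iff)
    with e N have "u \<in> ?U" "N \<in> ?P u" by auto
    then show "N \<in> (\<Union>u\<in>?U. ?P u)" by blast
  qed auto
  then have "pm (V, colour_edges V) = card (\<Union>u\<in>?U. ?P u)" by (simp add: pm_def)
  also have "\<dots> = (\<Sum>u\<in>?U. card (?P u))"
  proof (rule card_UN_disjoint)
    show "\<forall>u\<in>?U. finite (?P u)"
      by (intro ballI finite_subset[OF _ finite_matchings[OF assms(1)]]) auto
    show "\<forall>u\<in>?U. \<forall>w\<in>?U. u \<noteq> w \<longrightarrow> ?P u \<inter> ?P w = {}"
    proof (intro ballI impI)
      fix u w assume uw: "u \<in> ?U" "w \<in> ?U" "u \<noteq> w"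
      have False if "N \<in> ?P u \<inter> ?P w" for N
      proof -
        have "{v, u} = {v, w}"
          using disjointD[OF perfect_matching_disjoint, of V N "{v, u}" "{v, w}"] that by auto
        then show False using uw by (auto simp: doubleton_eq_iff)
      qed
      then show "?P u \<inter> ?P w = {}" by blast
    qed
  qed (use assms in auto)
  also have "\<dots> = (\<Sum>u\<in>?U. pm (V - {v, u}, colour_edges (V - {v, u})))"
  proof (rule sum.cong[OF refl])
    fix u assume "u \<in> ?U"
    then have "{{v, u}} \<subseteq> colour_edges V" using assms(2) unfolding colour_edges_def by blast
    from card_matchings_containing[OF this]
    show "card (?P u) = pm (V - {v, u}, colour_edges (V - {v, u}))" by simp
  qed
  finally show ?thesis .
qed

section \<open>Recursive count and closed form\<close>

text \<open>The recursion matches a vertex of the first nonempty class. The truncated \<open>b - 1\<close> and \<open>c - 1\<close>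
  are harmless, because the factor in front vanishes when \<open>b = 0\<close> or \<open>c = 0\<close>.\<close>

fun tri_count :: "nat \<Rightarrow> nat \<Rightarrow> nat \<Rightarrow> nat" where
  "tri_count 0 0 0 = 1"
| "tri_count 0 0 (Suc c) = 0"
| "tri_count 0 (Suc b) c = c * tri_count 0 b (c - 1)"
| "tri_count (Suc a) b c = b * tri_count a (b - 1) c + c * tri_count a b (c - 1)"

definition colour_class :: "(nat \<times> nat) set \<Rightarrow> nat \<Rightarrow> (nat \<times> nat) set" where
  "colour_class V i = {v \<in> V. fst v = i}"

lemma finite_colour_class [simp]: "finite V \<Longrightarrow> finite (colour_class V i)"
  by (simp add: colour_class_def)

lemma card_colour_class_remove:
  assumes "finite V" "u \<in> colour_class V i" "v \<in> colour_class V j" "i \<noteq> j"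
  shows "card (colour_class (V - {u, v}) k)
         = card (colour_class V k) - (if k = i \<or> k = j then 1 else 0)"
proof -
  have "colour_class (V - {u, v}) k
        = (if k = i then colour_class V k - {u} else if k = j then colour_class V k - {v}
           else colour_class V k)"
    using assms by (auto simp: colour_class_def)
  then show ?thesis using assms by auto
qed

lemma other_colours:
  assumes "fst ` V \<subseteq> {0, 1, 2}" "{i, j, k} = {0, 1, 2}" "distinct [i, j, k]"
    and "v \<in> colour_class V i"
  shows "{u. u \<in> V \<and> fst u \<noteq> fst v} = colour_class V j \<union> colour_class V k"
proof -
  have "fst u \<in> {i, j, k}" if "u \<in> V" for u using assms(1,2) that by blast
  then show ?thesis using assms(3,4) unfolding colour_class_def by fastforce
qed

text \<open>The induction follows the recursion of \<open>tri_count\<close> with \<open>V\<close>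
  arbitrary: a vertex of the first nonempty class is matched, and both endpoints are
  deleted.\<close>

lemma pm_eq_tri_count:
  assumes "finite V" "fst ` V \<subseteq> {0, 1, 2}"
  shows "pm (V, colour_edges V)
         = tri_count (card (colour_class V 0)) (card (colour_class V 1)) (card (colour_class V 2))"
proof -
  define a b c where "a = card (colour_class V 0)" and "b = card (colour_class V 1)"
    and "c = card (colour_class V 2)"
  have "pm (V, colour_edges V) = tri_count a b c"
    using assms a_def b_def c_def
  proof (induction a b c arbitrary: V rule: tri_count.induct)
    case 1
    then have "\<forall>i\<in>{0, 1, 2}. colour_class V i = {}" by simp
    then have "V = {}" using "1.prems"(2) unfolding colour_class_def by blast
    then have "{N. perfect_matching (V, colour_edges V) N} = {{}}"
      by (auto simp: perfect_matching_def colour_edges_def)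
    then show ?case by (simp add: pm_def)
  next
    case (2 c)
    have "card (colour_class V 2) > 0" using "2.prems" by simp
    then obtain v where v: "v \<in> colour_class V 2" by (metis card_gt_0_iff ex_in_conv)
    \<comment> \<open>Only class 2 is inhabited, so \<open>v\<close> has no possible partner and the
      sum over partners is empty.\<close>
    have U: "{u. u \<in> V \<and> fst u \<noteq> fst v} = {}"
      using other_colours[OF "2.prems"(2) _ _ v, of 0 1] "2.prems" by auto
    have "v \<in> V" using v by (simp add: colour_class_def)
    then have "pm (V, colour_edges V) = 0"
      using pm_match_vertex[OF "2.prems"(1)] by (simp only: U sum.empty)
    then show ?case by simp
  next
    case (3 b c)
    have "card (colour_class V 1) > 0" using "3.prems" by simp
    then obtain v where v: "v \<in> colour_class V 1" by (metis card_gt_0_iff ex_in_conv)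
    have U: "{u. u \<in> V \<and> fst u \<noteq> fst v} = colour_class V 2"
      using other_colours[OF "3.prems"(2) _ _ v, of 0 2] "3.prems" by auto
    have "pm (V - {v, u}, colour_edges (V - {v, u})) = tri_count 0 b (c - 1)"
      if u: "u \<in> colour_class V 2" for u
      using "3.prems" by (intro "3.IH") (auto simp: card_colour_class_remove[OF _ v u])
    moreover have "v \<in> V" using v by (simp add: colour_class_def)
    ultimately show ?case
      unfolding tri_count.simps using pm_match_vertex[of V v] U "3.prems" by simp
  next
    case (4 a b c)
    have "card (colour_class V 0) > 0" using "4.prems" by simp
    then obtain v where v: "v \<in> colour_class V 0" by (metis card_gt_0_iff ex_in_conv)
    have U: "{u. u \<in> V \<and> fst u \<noteq> fst v} = colour_class V 1 \<union> colour_class V 2"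
      by (rule other_colours[OF "4.prems"(2) _ _ v]) auto
    have 1: "pm (V - {v, u}, colour_edges (V - {v, u})) = tri_count a (b - 1) c"
      if u: "u \<in> colour_class V 1" for u
      using "4.prems" by (intro "4.IH"(1)) (auto simp: card_colour_class_remove[OF _ v u])
    have 2: "pm (V - {v, u}, colour_edges (V - {v, u})) = tri_count a b (c - 1)"
      if u: "u \<in> colour_class V 2" for u
      using "4.prems" by (intro "4.IH"(2)) (auto simp: card_colour_class_remove[OF _ v u])
    have "v \<in> V" using v by (simp add: colour_class_def)
    then have "pm (V, colour_edges V) =
       (\<Sum>u\<in>colour_class V 1 \<union> colour_class V 2. pm (V - {v, u}, colour_edges (V - {v, u})))"
      using pm_match_vertex[of V v] 4 U by simp
    also have "\<dots> = (\<Sum>u\<in>colour_class V 1. pm (V - {v, u}, colour_edges (V - {v, u})))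
       + (\<Sum>u\<in>colour_class V 2. pm (V - {v, u}, colour_edges (V - {v, u})))"
      using 4 by (intro sum.union_disjoint) (auto simp: colour_class_def)
    also have "\<dots> = tri_count (Suc a) b c"
    proof -
      have "(\<Sum>u\<in>colour_class V 1. pm (V - {v, u}, colour_edges (V - {v, u})))
          = b * tri_count a (b - 1) c"
        using sum.cong[OF refl 1] unfolding "4.prems"(4) by simp
      moreover have "(\<Sum>u\<in>colour_class V 2. pm (V - {v, u}, colour_edges (V - {v, u})))
          = c * tri_count a b (c - 1)"
        using sum.cong[OF refl 2] unfolding "4.prems"(5) by simp
      ultimately show ?thesis by (simp only: tri_count.simps)
    qed
    finally show ?case .
  qed
  then show ?thesis by (simp add: a_def b_def c_def)
qed

text \<open>A class larger than the other two together cannot be matched into them. This settles the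
  boundary cases of the closed form.\<close>

lemma tri_count_eq_0: "c > a + b \<or> b > a + c \<Longrightarrow> tri_count a b c = 0"
proof (induction a b c rule: tri_count.induct)
  case (3 b c)
  then show ?case by (cases c) auto
next
  case (4 a b c)
  then show ?case by (cases b; cases c) auto
qed auto

lemma tri_count_0: "tri_count 0 n n = fact n"
  by (induction n) auto

text \<open>Here \<open>x\<close>, \<open>y\<close>, \<open>z\<close> are the numbers of edges
  between classes 0 and 1, 0 and 2, 1 and 2; the class sizes determine them. Matching a vertex of
  class 0 lowers \<open>x\<close> or \<open>y\<close> by one, hence the induction on
  \<open>x + y\<close>. The denominator is multiplied out to stay within the naturals.\<close>

lemma tri_count_closed:
  "tri_count (x + y) (x + z) (y + z) * (fact x * fact y * fact z)
   = fact (x + y) * fact (x + z) * fact (y + z)"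
proof (induction "x + y" arbitrary: x y)
  case 0
  then show ?case by (simp add: tri_count_0)
next
  case (Suc n)
  have 1: "(x + z) * tri_count n (x + z - 1) (y + z) * (fact x * fact y * fact z)
     = x * fact n * fact (x + z) * fact (y + z)"
  proof (cases x)
    \<comment> \<open>No induction hypothesis is available for \<open>x - 1\<close>. Either
      \<open>z = 0\<close> and the factor \<open>x + z\<close> vanishes, or the sizes are
      \<open>y - 1\<close>, \<open>z - 1\<close>, \<open>y + z\<close> and the last class is too
      large.\<close>
    case 0
    then have "z = 0 \<or> tri_count n (x + z - 1) (y + z) = 0"
      using Suc.hyps(2) by (cases z) (auto intro!: tri_count_eq_0)
    then show ?thesis using 0 by auto
  next
    case (Suc x')
    then show ?thesis using Suc.hyps(1)[of x' y] Suc.hyps(2) by (simp add: algebra_simps)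
  qed
  have 2: "(y + z) * tri_count n (x + z) (y + z - 1) * (fact x * fact y * fact z)
     = y * fact n * fact (x + z) * fact (y + z)"
  proof (cases y)
    case 0
    then have "z = 0 \<or> tri_count n (x + z) (y + z - 1) = 0"
      using Suc.hyps(2) by (cases z) (auto intro!: tri_count_eq_0)
    then show ?thesis using 0 by auto
  next
    case (Suc y')
    then show ?thesis using Suc.hyps(1)[of x y'] Suc.hyps(2) by (simp add: algebra_simps)
  qed
  \<comment> \<open>The two contributions carry the weights \<open>x\<close> and \<open>y\<close>,
    which add up to the missing factor \<open>Suc n = x + y\<close> of the factorial.\<close>
  have "tri_count (x + y) (x + z) (y + z) * (fact x * fact y * fact z)
     = (x + y) * fact n * fact (x + z) * fact (y + z)"
    unfolding Suc.hyps(2)[symmetric] tri_count.simps distrib_right[of _ _ "_ * _"] 1 2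
    by (simp only: Suc.hyps(2) flip: distrib_right)
  then show ?case by (simp only: Suc.hyps(2)[symmetric] fact_Suc of_nat_id)
qed

subsection \<open>Inclusion-exclusion\<close>

lemma sum_Pow_card:
  fixes h :: "nat \<Rightarrow> real"
  assumes "finite A"
  shows "(\<Sum>S\<in>Pow A. h (card S)) = (\<Sum>i\<le>card A. real (card A choose i) * h i)"
proof -
  have "(\<Sum>S\<in>Pow A. h (card S)) = (\<Sum>i\<le>card A. \<Sum>S | S \<in> Pow A \<and> card S = i. h (card S))"
    using assms by (intro sum.group[symmetric]) (auto intro: card_mono)
  also have "\<dots> = (\<Sum>i\<le>card A. \<Sum>S | S \<subseteq> A \<and> card S = i. h i)"
    by (intro sum.cong) auto
  finally show ?thesis using assms by (simp add: n_subsets)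
qed

text \<open>A subset of a disjoint union is determined by its traces on the two parts, which can be
  chosen independently.\<close>

lemma sum_Pow_Un:
  assumes "A \<inter> B = {}"
  shows "(\<Sum>S\<in>Pow (A \<union> B). g S) = (\<Sum>S\<in>Pow A. \<Sum>T\<in>Pow B. g (S \<union> T))"
  unfolding sum.cartesian_product
  by (rule sum.reindex_bij_witness[of _ "\<lambda>(S, T). S \<union> T" "\<lambda>S. (S \<inter> A, S \<inter> B)"])
     (use assms in \<open>auto simp flip: Int_Un_distrib simp: Un_absorb2 Int_absorb2\<close>)

text \<open>This is the binomial expansion of \<open>(1 - 1) ^ card A\<close>.\<close>

lemma alternating_sum_Pow:
  assumes "finite A"
  shows "(\<Sum>S\<in>Pow A. (-1) ^ card S) = (if A = {} then 1 else 0 :: real)"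
  using assms choose_alternating_sum[of "card A", where 'a = real]
  by (auto simp: sum_Pow_card card_gt_0_iff mult.commute)

text \<open>After exchanging the sums, each \<open>N\<close> contributes the alternating sum over
  the subsets of \<open>N \<inter> M\<close>, which is 1 if this intersection is empty and 0
  otherwise.\<close>

lemma card_avoiding:
  assumes "finite P" "finite M"
  shows "real (card {N \<in> P. N \<inter> M = {}})
         = (\<Sum>S\<in>Pow M. (-1) ^ card S * real (card {N \<in> P. S \<subseteq> N}))"
proof -
  have "(\<Sum>S\<in>Pow M. (-1) ^ card S * real (card {N \<in> P. S \<subseteq> N}))
        = (\<Sum>S\<in>Pow M. \<Sum>N | N \<in> P \<and> S \<subseteq> N. (-1) ^ card S)"
    by (simp add: mult.commute)
  also have "\<dots> = (\<Sum>N\<in>P. \<Sum>S | S \<in> Pow M \<and> S \<subseteq> N. (-1) ^ card S)"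
    using assms by (intro sum.swap_restrict) auto
  also have "\<dots> = (\<Sum>N\<in>P. \<Sum>S\<in>Pow (N \<inter> M). (-1) ^ card S)"
    by (intro sum.cong refl) auto
  also have "\<dots> = (\<Sum>N\<in>P. if N \<inter> M = {} then 1 else 0)"
    using assms by (intro sum.cong refl alternating_sum_Pow) auto
  also have "\<dots> = real (card {N \<in> P. N \<inter> M = {}})"
    using assms by (simp add: sum.If_cases Int_def)
  finally show ?thesis by simp
qed

section \<open>Edge types\<close>

text \<open>Every edge avoids exactly one of the three classes, so the class it avoids encodes its type.\<close>

definition missing :: "(nat \<times> nat) set set \<Rightarrow> nat \<Rightarrow> (nat \<times> nat) set set" where
  "missing S i = {e \<in> S. i \<notin> fst ` e}"

lemma missing_subset: "missing S i \<subseteq> S"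
  by (auto simp: missing_def)

lemma finite_missing [simp]: "finite S \<Longrightarrow> finite (missing S i)"
  by (simp add: missing_def)

lemma missing_cases:
  assumes "fst ` V \<subseteq> {0, 1, 2}" "S \<subseteq> colour_edges V"
  shows "missing S 0 \<union> missing S 1 \<union> missing S 2 = S"
    and "i \<noteq> j \<Longrightarrow> i < 3 \<Longrightarrow> j < 3 \<Longrightarrow> missing S i \<inter> missing S j = {}"
proof -
  \<comment> \<open>Both claims rest on this: the endpoints show exactly two of the three colours,
    so some colour is absent, and no two colours can be absent together.\<close>
  have *: "\<exists>a b. fst ` e = {a, b} \<and> a \<noteq> b \<and> {a, b} \<subseteq> {0, 1, 2}" if e: "e \<in> S" for e
  proof -
    from e assms obtain u v where uv: "e = {u, v}" "u \<in> V" "v \<in> V" "fst u \<noteq> fst v"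
      by (auto simp: colour_edges_def)
    then show ?thesis using assms(1) by (intro exI[of _ "fst u"] exI[of _ "fst v"]) auto
  qed
  have "e \<in> missing S 0 \<union> missing S 1 \<union> missing S 2" if e: "e \<in> S" for e
  proof -
    from *[OF e] obtain a b where ab: "fst ` e = {a, b}" by blast
    have "0 \<notin> {a, b} \<or> 1 \<notin> {a, b} \<or> 2 \<notin> {a, b}" by auto
    then show ?thesis using e unfolding missing_def ab[symmetric] by blast
  qed
  then show "missing S 0 \<union> missing S 1 \<union> missing S 2 = S"
    using missing_subset by blast
  show "missing S i \<inter> missing S j = {}" if "i \<noteq> j" "i < 3" "j < 3"
  proof -
    have "{i, j} \<inter> fst ` e \<noteq> {}" if e: "e \<in> S" for e
    proof -
      from *[OF e] obtain a b where ab: "fst ` e = {a, b}" "a \<noteq> b" "{a, b} \<subseteq> {0, 1, 2}" by blast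
      have "{i, j} \<subseteq> {0, 1, 2}" using \<open>i < 3\<close> \<open>j < 3\<close> by auto
      then show ?thesis unfolding ab(1) using \<open>i \<noteq> j\<close> ab(2,3) by auto
    qed
    then show ?thesis by (auto simp: missing_def)
  qed
qed

text \<open>An edge has one endpoint in class \<open>i\<close> if it does not avoid that class, and
  none otherwise. The edges not avoiding \<open>i\<close> are those avoiding \<open>j\<close> or
  \<open>k\<close>, and disjointness of \<open>S\<close> prevents double counting.\<close>

lemma card_colour_class_Union:
  assumes "finite V" "fst ` V \<subseteq> {0, 1, 2}" "S \<subseteq> colour_edges V" "disjoint S"
    and ijk: "{i, j, k} = {0, 1, 2}" "distinct [i, j, k]"
  shows "card (colour_class (\<Union>S) i) = card (missing S j) + card (missing S k)"
proof -
  have finS: "finite S" by (rule finite_subset[OF assms(3) finite_colour_edges[OF assms(1)]])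
  have "{i, j, k} \<subseteq> {0, 1, 2}" using ijk(1) by (rule equalityD1)
  then have lt: "i < 3" "j < 3" "k < 3" by auto
  have fin: "finite e" if "e \<in> S" for e
    using that assms(3) by (auto simp: colour_edges_def)
  have one: "card (colour_class e i) = (if i \<in> fst ` e then 1 else 0)" if "e \<in> S" for e
  proof -
    from that assms(3) obtain u v where uv: "e = {u, v}" "fst u \<noteq> fst v"
      by (auto simp: colour_edges_def)
    then have "colour_class e i = (if fst u = i then {u} else if fst v = i then {v} else {})"
      by (auto simp: colour_class_def)
    then show ?thesis using uv by auto
  qed
  have "colour_class (\<Union>S) i = (\<Union>e\<in>S. colour_class e i)" by (auto simp: colour_class_def)
  moreover have "card (\<Union>e\<in>S. colour_class e i) = (\<Sum>e\<in>S. card (colour_class e i))"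
  proof (rule card_UN_disjoint[OF finS])
    show "\<forall>e\<in>S. finite (colour_class e i)" using fin by simp
    show "\<forall>e\<in>S. \<forall>f\<in>S. e \<noteq> f \<longrightarrow> colour_class e i \<inter> colour_class f i = {}"
      using disjointD[OF assms(4)] unfolding colour_class_def by blast
  qed
  ultimately have "card (colour_class (\<Union>S) i) = (\<Sum>e\<in>S. card (colour_class e i))" by simp
  also have "\<dots> = card {e \<in> S. i \<in> fst ` e}"
    using finS one by (simp add: sum.If_cases Int_def)
  also have "{e \<in> S. i \<in> fst ` e} = missing S j \<union> missing S k"
  proof -
    \<comment> \<open>The equation \<open>{i, j, k} = {0, 1, 2}\<close> is pushed through a union
      over indices, which relabels the decomposition of \<open>S\<close>.\<close>
    have "missing S i \<union> missing S j \<union> missing S k = S"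
      using missing_cases(1)[OF assms(2,3)] arg_cong[OF ijk(1), of "\<lambda>I. \<Union>l\<in>I. missing S l"]
      by (simp add: Un_assoc)
    moreover have "missing S i \<inter> missing S j = {}" "missing S i \<inter> missing S k = {}"
      using missing_cases(2)[OF assms(2,3)] ijk(2) lt by auto
    ultimately show ?thesis unfolding missing_def by blast
  qed
  also have "card \<dots> = card (missing S j) + card (missing S k)"
    using missing_cases(2)[OF assms(2,3)] ijk(2) lt finS by (intro card_Un_disjoint) auto
  finally show ?thesis .
qed

lemma card_colour_class_tripartite:
  assumes "i \<in> {0, 1, 2}"
  shows "card (colour_class (tripartite_verts n n n) i) = n"
proof -
  have "colour_class (tripartite_verts n n n) i = {i} \<times> {..<n}"
    using assms by (auto simp: colour_class_def tripartite_verts_def)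
  then show ?thesis by (simp add: card_cartesian_product)
qed

lemma tripartite_verts_props:
  "finite (tripartite_verts a b c)" "fst ` tripartite_verts a b c \<subseteq> {0, 1, 2}"
  by (auto simp: tripartite_verts_def)

lemma card_colour_class_Diff_tripartite:
  assumes "S \<subseteq> colour_edges (tripartite_verts n n n)" "disjoint S"
    and "{i, j, k} = {0, 1, 2}" "distinct [i, j, k]"
  shows "card (colour_class (tripartite_verts n n n - \<Union>S) i)
         = n - (card (missing S j) + card (missing S k))"
proof -
  have S: "\<Union>S \<subseteq> tripartite_verts n n n" using assms(1) colour_edges_subset by blast
  have "i \<in> {0, 1, 2}" unfolding assms(3)[symmetric] by simp
  then have "card (colour_class (tripartite_verts n n n) i) = n"
    by (rule card_colour_class_tripartite)
  moreover have "colour_class (tripartite_verts n n n - \<Union>S) i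
      = colour_class (tripartite_verts n n n) i - colour_class (\<Union>S) i"
    by (auto simp: colour_class_def)
  moreover have "colour_class (\<Union>S) i \<subseteq> colour_class (tripartite_verts n n n) i"
    using S by (auto simp: colour_class_def)
  moreover have "finite (colour_class (\<Union>S) i)"
    by (rule finite_colour_class[OF finite_subset[OF S tripartite_verts_props(1)]])
  ultimately show ?thesis
    using card_colour_class_Union[OF tripartite_verts_props assms] by (simp add: card_Diff_subset)
qed

text \<open>Counting the vertices of each class shows that any two of the three cardinalities add up
  to \<open>2 * m\<close>, so all three equal \<open>m\<close>.\<close>

lemma card_missing_perfect_matching:
  assumes "perfect_matching (complete_tripartite (2*m) (2*m) (2*m)) M" "i < 3"
  shows "card (missing M i) = m"
proof -
  let ?V = "tripartite_verts (2*m) (2*m) (2*m)"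
  have M: "perfect_matching (?V, colour_edges ?V) M"
    using assms by (simp add: complete_tripartite_eq)
  then have sub: "M \<subseteq> colour_edges ?V" by (simp add: perfect_matching_def)
  have "\<Union>M = ?V"
    using M sub colour_edges_subset unfolding perfect_matching_def fst_conv snd_conv by blast
  then have "card (colour_class (\<Union>M) l) = 2 * m" if "l \<in> {0, 1, 2}" for l
    using that by (simp only: card_colour_class_tripartite)
  note this[of 0] this[of 1] this[of 2]
  moreover note card_colour_class_Union[OF tripartite_verts_props sub perfect_matching_disjoint[OF M]]
  note this[of 0 1 2] this[of 1 0 2] this[of 2 0 1]
  ultimately have "card (missing M 0) = m \<and> card (missing M 1) = m \<and> card (missing M 2) = m"
    by (simp add: insert_commute)
  moreover have "i = 0 \<or> i = 1 \<or> i = 2" using assms(2) by auto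
  ultimately show ?thesis by auto
qed

section \<open>Counting by edge types\<close>

text \<open>Number of perfect matchings left after removing the endpoints of disjoint edges, \<open>i\<close> of
  them avoiding class 0, \<open>j\<close> class 1 and \<open>k\<close> class 2; meaningful only for \<open>i, j, k \<le> m\<close>.\<close>

definition matchings_through :: "nat \<Rightarrow> nat \<Rightarrow> nat \<Rightarrow> nat \<Rightarrow> real" where
  "matchings_through m i j k = fact (2*m - (i + j)) * fact (2*m - (i + k)) * fact (2*m - (j + k))
     / (fact (m - i) * fact (m - j) * fact (m - k))"

text \<open>The closed form applies with \<open>m - k\<close>, \<open>m - j\<close>,
  \<open>m - i\<close> edges left of the three types. The bounds by \<open>m\<close> make the
  truncated subtractions exact.\<close>

lemma pm_Diff_Union:
  assumes "S \<subseteq> colour_edges (tripartite_verts (2*m) (2*m) (2*m))" "disjoint S"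
    and "card (missing S 0) \<le> m" "card (missing S 1) \<le> m" "card (missing S 2) \<le> m"
  defines "W \<equiv> tripartite_verts (2*m) (2*m) (2*m) - \<Union>S"
  shows "real (pm (W, colour_edges W))
    = matchings_through m (card (missing S 0)) (card (missing S 1)) (card (missing S 2))"
proof -
  define i j k where ijk: "i = card (missing S 0)" "j = card (missing S 1)" "k = card (missing S 2)"
  note c = card_colour_class_Diff_tripartite[OF assms(1,2), folded W_def]
  have W: "finite W" "fst ` W \<subseteq> {0, 1, 2}"
    using tripartite_verts_props[of "2*m" "2*m" "2*m"] by (auto simp: W_def)
  have le: "i \<le> m" "j \<le> m" "k \<le> m" using assms(3-5) ijk by auto
  have "pm (W, colour_edges W) = tri_count (2*m - (j + k)) (2*m - (i + k)) (2*m - (i + j))"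
    using pm_eq_tri_count[OF W] c[of 0 1 2] c[of 1 0 2] c[of 2 0 1] ijk
    by (simp add: insert_commute)
  moreover have "2*m - (j + k) = (m - k) + (m - j)" "2*m - (i + k) = (m - k) + (m - i)"
    "2*m - (i + j) = (m - j) + (m - i)" using le by auto
  moreover note tri_count_closed[of "m - k" "m - j" "m - i", THEN arg_cong[of _ _ real]]
  ultimately show ?thesis
    unfolding matchings_through_def ijk[symmetric] by (simp add: field_simps)
qed

lemma pm_complete_tripartite:
  "real (pm (complete_tripartite (2*m) (2*m) (2*m))) = matchings_through m 0 0 0"
  using pm_Diff_Union[of "{}" m] by (simp add: complete_tripartite_eq missing_def disjoint_def)

text \<open>A subset of \<open>M\<close> splits into its parts of the three types. Its contribution
  depends only on their sizes, and \<open>M\<close> has \<open>m\<close> edges of each type, hence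
  the binomial coefficients.\<close>

lemma pm_delete_edges:
  assumes "perfect_matching (complete_tripartite (2*m) (2*m) (2*m)) M"
  shows "real (pm (delete_edges (complete_tripartite (2*m) (2*m) (2*m)) M))
    = (\<Sum>i\<le>m. \<Sum>j\<le>m. \<Sum>k\<le>m. real (m choose i) * real (m choose j) * real (m choose k)
         * (-1) ^ (i + j + k) * matchings_through m i j k)"
proof -
  define V where "V = tripartite_verts (2*m) (2*m) (2*m)"
  have V: "finite V" "fst ` V \<subseteq> {0, 1, 2}" unfolding V_def by (rule tripartite_verts_props)+
  have M: "perfect_matching (V, colour_edges V) M"
    using assms by (simp add: complete_tripartite_eq V_def)
  then have sub: "M \<subseteq> colour_edges V" by (simp add: perfect_matching_def)
  have finM: "finite M" by (rule finite_perfect_matching[OF V(1) M])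
  have disjM: "disjoint M" by (rule perfect_matching_disjoint[OF M])
  define A where "A = missing M"
  have A: "card (A 0) = m" "card (A 1) = m" "card (A 2) = m"
    using card_missing_perfect_matching[OF assms] by (auto simp: A_def)
  have finA: "finite (A i)" for i using finM by (simp add: A_def)
  have AM: "A 0 \<union> A 1 \<union> A 2 = M" unfolding A_def by (rule missing_cases(1)[OF V(2) sub])
  have Adisj: "A i \<inter> A j = {}" if "i \<noteq> j" "i < 3" "j < 3" for i j
    unfolding A_def by (rule missing_cases(2)[OF V(2) sub that])
  let ?h = "\<lambda>i j k. (-1) ^ (i + j + k) * matchings_through m i j k"
  have through: "(-1) ^ card (S \<union> T \<union> U)
      * real (card {N \<in> {N. perfect_matching (V, colour_edges V) N}. S \<union> T \<union> U \<subseteq> N})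
      = ?h (card S) (card T) (card U)"
    if STU: "S \<in> Pow (A 0)" "T \<in> Pow (A 1)" "U \<in> Pow (A 2)" for S T U
  proof -
    let ?S = "S \<union> T \<union> U"
    have fin: "finite S" "finite T" "finite U" using STU finA by (auto intro: finite_subset)
    have d: "S \<inter> T = {}" "(S \<union> T) \<inter> U = {}"
      using STU Adisj[of 0 1] Adisj[of 0 2] Adisj[of 1 2] by auto
    \<comment> \<open>The parts can be recovered from their union, because each lies in the edges of
      one type and the types are disjoint.\<close>
    have m: "missing ?S 0 = S" "missing ?S 1 = T" "missing ?S 2 = U"
      using STU Adisj[of 0 1] Adisj[of 0 2] Adisj[of 1 2] unfolding A_def missing_def by auto
    have le: "card S \<le> m" "card T \<le> m" "card U \<le> m"
      using STU A finA by (metis PowD card_mono)+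
    have SM: "?S \<subseteq> M" using STU AM by auto
    have "disjoint ?S" by (rule disjointI) (use SM disjointD[OF disjM] in blast)
    moreover have "?S \<subseteq> colour_edges V" using SM sub by auto
    ultimately have "real (card {N. perfect_matching (V, colour_edges V) N \<and> ?S \<subseteq> N})
       = matchings_through m (card S) (card T) (card U)"
      using pm_Diff_Union[of ?S m, folded V_def, unfolded m] le card_matchings_containing[of ?S V]
      by simp
    moreover have "card ?S = card S + card T + card U"
      using fin d by (simp add: card_Un_disjoint)
    ultimately show ?thesis by simp
  qed
  \<comment> \<open>The perfect matchings after deletion of \<open>M\<close> are those of the full
    graph that are disjoint from \<open>M\<close>.\<close>
  have "pm (delete_edges (complete_tripartite (2*m) (2*m) (2*m)) M)
      = card {N \<in> {N. perfect_matching (V, colour_edges V) N}. N \<inter> M = {}}"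
    unfolding pm_def complete_tripartite_eq V_def[symmetric] delete_edges_def perfect_matching_def
    by (intro arg_cong[of _ _ card]) auto
  also have "real \<dots> = (\<Sum>S\<in>Pow M. (-1) ^ card S
      * real (card {N \<in> {N. perfect_matching (V, colour_edges V) N}. S \<subseteq> N}))"
    by (rule card_avoiding[OF finite_matchings[OF V(1)] finM])
  also have "\<dots> = (\<Sum>S\<in>Pow (A 0). \<Sum>T\<in>Pow (A 1). \<Sum>U\<in>Pow (A 2). ?h (card S) (card T) (card U))"
  proof -
    have "(A 0 \<union> A 1) \<inter> A 2 = {}" using Adisj[of 0 2] Adisj[of 1 2] by auto
    then show ?thesis
      unfolding AM[symmetric] using Adisj[of 0 1]
      by (subst sum_Pow_Un, simp, subst sum_Pow_Un, simp) (intro sum.cong refl through)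
  qed
  \<comment> \<open>From the innermost sum outwards, subsets are grouped by size.\<close>
  also have "\<dots> = (\<Sum>S\<in>Pow (A 0). \<Sum>T\<in>Pow (A 1). \<Sum>k\<le>m. (m choose k) * ?h (card S) (card T) k)"
    using sum_Pow_card[OF finA[of 2], where h = "\<lambda>k. ?h i j k" for i j] by (simp only: A)
  also have "\<dots> = (\<Sum>S\<in>Pow (A 0). \<Sum>j\<le>m. (m choose j) *
       (\<Sum>k\<le>m. (m choose k) * ?h (card S) j k))"
    using sum_Pow_card[OF finA[of 1], where h = "\<lambda>j. \<Sum>k\<le>m. (m choose k) * ?h i j k" for i]
    by (simp only: A)
  also have "\<dots> = (\<Sum>i\<le>m. (m choose i) * (\<Sum>j\<le>m. (m choose j) * (\<Sum>k\<le>m. (m choose k) * ?h i j k)))"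
    using sum_Pow_card[OF finA[of 0],
        where h = "\<lambda>i. \<Sum>j\<le>m. (m choose j) * (\<Sum>k\<le>m. (m choose k) * ?h i j k)"]
    by (simp only: A)
  finally show ?thesis by (simp add: sum_distrib_left mult_ac)
qed

subsection \<open>The limit\<close>

text \<open>The truncated subtraction makes the product vanish for \<open>s > n\<close>, which later
  cuts off the infinite series.\<close>

definition falling :: "nat \<Rightarrow> nat \<Rightarrow> real" where
  "falling n s = (\<Prod>l<s. real (n - l))"

lemma falling_nonneg: "falling n s \<ge> 0"
  by (simp add: falling_def prod_nonneg)

lemma falling_pos: "s \<le> n \<Longrightarrow> falling n s > 0"
  by (auto simp: falling_def intro!: prod_pos)

lemma falling_eq_0: "n < s \<Longrightarrow> falling n s = 0"
  by (auto simp: falling_def intro!: prod_zero bexI[of _ n])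

lemma falling_eq_fact:
  assumes "s \<le> n"
  shows "falling n s = fact n / fact (n - s)"
proof -
  have "falling n s * fact (n - s) = fact n"
    using assms
  proof (induction s)
    case (Suc s)
    then have "n - s = Suc (n - Suc s)" by simp
    then have "(fact (n - s) :: real) = real (n - s) * fact (n - Suc s)"
      by (metis fact_Suc of_nat_mult)
    moreover have "falling n (Suc s) = falling n s * real (n - s)" by (simp add: falling_def)
    ultimately show ?case using Suc by (simp only: mult.assoc)
  qed (simp add: falling_def)
  then show ?thesis by (simp add: eq_divide_eq)
qed

lemma falling_add: "falling n (i + j) = falling n i * falling (n - i) j"
proof (induction j)
  case (Suc j)
  then show ?case by (simp add: falling_def)
qed (simp add: falling_def)

lemma falling_mono: "n \<le> n' \<Longrightarrow> falling n s \<le> falling n' s"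
  unfolding falling_def by (intro prod_mono) auto

text \<open>The right side splits off its first \<open>i\<close> factors as
  \<open>falling (2 * m) i * falling (2 * m - i) j\<close>, and both \<open>2 * m\<close> and
  \<open>2 * m - i\<close> are at least \<open>m\<close>.\<close>

lemma falling_mult_le:
  assumes "i \<le> m"
  shows "falling m i * falling m j \<le> falling (2 * m) (i + j)"
  unfolding falling_add using assms
  by (intro mult_mono falling_mono falling_nonneg) auto

text \<open>The number \<open>s\<close> of factors is fixed, and each factor divided by
  \<open>m\<close> tends to \<open>a\<close>.\<close>

lemma falling_asymptotic: "(\<lambda>m. falling (a * m) s / real m ^ s) \<longlonglongrightarrow> real a ^ s"
proof -
  have "(\<lambda>m. real (a * m - l) / real m) \<longlonglongrightarrow> real a" for l
  proof (cases "a = 0")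
    case False
    have "(\<lambda>m. real a - real l / real m) \<longlonglongrightarrow> real a - 0"
      by (intro tendsto_intros lim_const_over_n)
    moreover have "\<forall>\<^sub>F m in sequentially. real a - real l / real m = real (a * m - l) / real m"
      \<comment> \<open>From \<open>m > l\<close> on, the truncated subtraction is exact and
        \<open>m\<close> is nonzero.\<close>
      using eventually_ge_at_top[of "Suc l"]
    proof eventually_elim
      case (elim m)
      have "m \<le> a * m" using False by simp
      with elim have "l \<le> a * m" by linarith
      then show ?case using elim by (simp add: of_nat_diff field_simps)
    qed
    ultimately show ?thesis by (simp add: tendsto_cong)
  qed simp
  then have "(\<lambda>m. \<Prod>l<s. real (a * m - l) / real m) \<longlonglongrightarrow> (\<Prod>l<s. real a)"
    by (intro tendsto_prod)
  then show ?thesis by (simp add: falling_def prod_dividef)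
qed

section \<open>Termwise limit and uniform bound\<close>

text \<open>The summand of the inclusion-exclusion formula, divided by the number of all perfect matchings.\<close>

definition ie_term :: "nat \<Rightarrow> nat \<Rightarrow> nat \<Rightarrow> nat \<Rightarrow> real" where
  "ie_term m i j k = (-1) ^ (i + j + k) * (falling m i * falling m j * falling m k)\<^sup>2
     / (falling (2*m) (i + j) * falling (2*m) (i + k) * falling (2*m) (j + k))
     / (fact i * fact j * fact k)"

lemma ie_term_eq_0: "m < i \<or> m < j \<or> m < k \<Longrightarrow> ie_term m i j k = 0"
  by (auto simp: ie_term_def falling_eq_0)

text \<open>Each binomial coefficient and each quotient \<open>fact m / fact (m - i)\<close> gives a
  factor \<open>falling m i\<close>, hence the square; the factorials of
  \<open>2*m - (i + j)\<close> and its analogues give the denominator.\<close>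

lemma ie_term_eq:
  assumes "i \<le> m" "j \<le> m" "k \<le> m"
  shows "real (m choose i) * real (m choose j) * real (m choose k)
     * (-1) ^ (i + j + k) * matchings_through m i j k / matchings_through m 0 0 0 = ie_term m i j k"
proof -
  have "i + j \<le> 2*m" "i + k \<le> 2*m" "j + k \<le> 2*m" using assms by auto
  then show ?thesis
    using assms unfolding ie_term_def matchings_through_def
    by (simp add: falling_eq_fact binomial_fact power2_eq_square) (simp add: field_simps)
qed

lemma abs_ie_term_le: "\<bar>ie_term m i j k\<bar> \<le> 1 / fact i * (1 / fact j) * (1 / fact k)"
proof (cases "i \<le> m \<and> j \<le> m \<and> k \<le> m")
  case True
  let ?D = "falling (2*m) (i + j) * falling (2*m) (i + k) * falling (2*m) (j + k)"
  have pos: "?D > 0" using True by (intro mult_pos_pos falling_pos) auto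
  \<comment> \<open>In the square each factor occurs twice, so it regroups into three mixed
    products, each bounded by one factor of \<open>?D\<close>.\<close>
  have "(falling m i * falling m j * falling m k)\<^sup>2
      = falling m i * falling m j * (falling m i * falling m k) * (falling m j * falling m k)"
    by (simp add: power2_eq_square)
  also have "\<dots> \<le> ?D"
    using True by (intro mult_mono falling_mult_le mult_nonneg_nonneg falling_nonneg) auto
  finally have "(falling m i * falling m j * falling m k)\<^sup>2 / ?D \<le> 1"
    using pos by simp
  then have "(falling m i * falling m j * falling m k)\<^sup>2 / ?D / (fact i * fact j * fact k)
      \<le> 1 / (fact i * fact j * fact k)"
    by (intro divide_right_mono) auto
  moreover have "\<bar>ie_term m i j k\<bar>
      = (falling m i * falling m j * falling m k)\<^sup>2 / ?D / (fact i * fact j * fact k)"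
    using pos unfolding ie_term_def by (simp add: abs_mult power_abs falling_nonneg)
  ultimately show ?thesis by simp
next
  case False
  then have "ie_term m i j k = 0" by (intro ie_term_eq_0) auto
  then show ?thesis by simp
qed

text \<open>Numerator and denominator both have order \<open>m ^ (2 * (i + j + k))\<close>. After
  scaling they tend to 1 and \<open>4 ^ (i + j + k)\<close> in absolute value.\<close>

lemma ie_term_limit:
  "(\<lambda>m. ie_term m i j k)
   \<longlonglongrightarrow> (-1/4) ^ i / fact i * ((-1/4) ^ j / fact j) * ((-1/4) ^ k / fact k)"
proof -
  let ?r = "\<lambda>a m s. falling (a * m) s / real m ^ s"
  let ?f = "\<lambda>m. (-1) ^ (i + j + k) * (?r 1 m i * ?r 1 m j * ?r 1 m k)\<^sup>2
     / (?r 2 m (i + j) * ?r 2 m (i + k) * ?r 2 m (j + k)) / (fact i * fact j * fact k)"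
  have "?f \<longlonglongrightarrow> (-1) ^ (i + j + k) * (real 1 ^ i * real 1 ^ j * real 1 ^ k)\<^sup>2
     / (real 2 ^ (i + j) * real 2 ^ (i + k) * real 2 ^ (j + k)) / (fact i * fact j * fact k)"
    by (intro tendsto_intros falling_asymptotic) auto
  also have "(-1) ^ (i + j + k) * (real 1 ^ i * real 1 ^ j * real 1 ^ k)\<^sup>2
     / (real 2 ^ (i + j) * real 2 ^ (i + k) * real 2 ^ (j + k)) / (fact i * fact j * fact k)
     = (-1/4) ^ i / fact i * ((-1/4) ^ j / fact j) * ((-1/4) ^ k / fact k)"
  proof -
    have four: "(4::real) ^ n = 2 ^ n * 2 ^ n" for n by (simp flip: power_mult_distrib)
    have minus: "(-1/4 :: real) ^ n = (-1) ^ n / (2 ^ n * 2 ^ n)" for n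
      by (simp only: power_divide four)
    show ?thesis unfolding minus by (simp add: power_add)
  qed
  finally have lim: "?f \<longlonglongrightarrow> (-1/4) ^ i / fact i * ((-1/4) ^ j / fact j) * ((-1/4) ^ k / fact k)" .
  moreover have "\<forall>\<^sub>F m in sequentially. ?f m = ie_term m i j k"
    using eventually_gt_at_top[of 0]
  proof eventually_elim
    case (elim m)
    \<comment> \<open>The power of \<open>m\<close> scaling the numerator and the denominator is the
      same \<open>q\<^sup>2\<close>, so it cancels.\<close>
    define q where "q = real m ^ (i + j + k)"
    have q: "q\<^sup>2 \<noteq> 0" using elim by (simp add: q_def)
    have "?r 1 m i * ?r 1 m j * ?r 1 m k = falling m i * falling m j * falling m k / q"
      by (simp add: q_def power_add)
    moreover have "?r 2 m (i + j) * ?r 2 m (i + k) * ?r 2 m (j + k)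
        = falling (2*m) (i + j) * falling (2*m) (i + k) * falling (2*m) (j + k) / q\<^sup>2"
      by (simp add: q_def power_add power2_eq_square mult_ac)
    ultimately show ?case
      using q unfolding ie_term_def by (simp only: power_divide times_divide_eq_right) simp
  qed
  ultimately show ?thesis by (rule Lim_transform_eventually)
qed

section \<open>Limits of triple series\<close>

lemma suminf_dominated_limit:
  fixes a :: "nat \<Rightarrow> nat \<Rightarrow> real"
  assumes "\<And>k. (\<lambda>n. a n k) \<longlonglongrightarrow> b k" "\<And>n k. \<bar>a n k\<bar> \<le> c k" "summable c"
  shows "(\<lambda>n. \<Sum>k. a n k) \<longlonglongrightarrow> (\<Sum>k. b k)"
proof -
  have "\<forall>\<^sub>F (k, n) in sequentially \<times>\<^sub>F sequentially. norm (a n k) \<le> c k"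
    using assms(2) by (intro always_eventually) auto
  from tannerys_theorem[OF assms(1) this assms(3)] show ?thesis by simp
qed

lemma abs_suminf_le:
  fixes a c :: "nat \<Rightarrow> real"
  assumes "\<And>k. \<bar>a k\<bar> \<le> c k" "summable c"
  shows "\<bar>\<Sum>k. a k\<bar> \<le> (\<Sum>k. c k)"
  using norm_suminf_le[of a c] assms by simp

text \<open>Dominated convergence is applied to the innermost sum first. Each summation replaces one
  factor \<open>b\<close> by \<open>l\<close> in the limit and one factor \<open>c\<close> by
  \<open>C\<close> in the majorant, so the next sum has the same shape.\<close>

lemma suminf_triple_limit:
  fixes t :: "nat \<Rightarrow> nat \<Rightarrow> nat \<Rightarrow> nat \<Rightarrow> real"
  assumes lim: "\<And>i j k. (\<lambda>m. t m i j k) \<longlonglongrightarrow> b i * b j * b k"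
    and bound: "\<And>m i j k. \<bar>t m i j k\<bar> \<le> c i * c j * c k"
    and c: "summable c" and b: "b sums l"
  shows "(\<lambda>m. \<Sum>i. \<Sum>j. \<Sum>k. t m i j k) \<longlonglongrightarrow> l * l * l"
proof -
  define C where "C = suminf c"
  have sb: "(\<Sum>k. x * b k) = x * l" for x
    using b suminf_mult[of b x] by (simp add: sums_iff)
  have sc: "summable (\<lambda>k. x * c k)" "(\<Sum>k. x * c k) = x * C" for x
    using c suminf_mult[of c x] by (simp_all add: C_def summable_mult)
  \<comment> \<open>The factors are reordered so that the next summation index comes last, as
    \<open>sb\<close> and \<open>sc\<close> require.\<close>
  have 1: "(\<lambda>m. \<Sum>k. t m i j k) \<longlonglongrightarrow> b i * l * b j" for i j
    using suminf_dominated_limit[OF lim[of i j] bound[of _ i j] sc(1)] unfolding sb by (simp only: mult_ac)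
  have b1: "\<bar>\<Sum>k. t m i j k\<bar> \<le> c i * C * c j" for m i j
    using abs_suminf_le[OF bound[of m i j] sc(1)] unfolding sc by (simp only: mult_ac)
  have 2: "(\<lambda>m. \<Sum>j. \<Sum>k. t m i j k) \<longlonglongrightarrow> l * l * b i" for i
    using suminf_dominated_limit[OF 1[of i] b1[of _ i] sc(1)] unfolding sb by (simp only: mult_ac)
  have b2: "\<bar>\<Sum>j. \<Sum>k. t m i j k\<bar> \<le> C * C * c i" for m i
    using abs_suminf_le[OF b1[of m i] sc(1)] unfolding sc by (simp only: mult_ac)
  show ?thesis
    using suminf_dominated_limit[OF 2 b2 sc(1)] by (simp add: sb)
qed

lemma ie_sum_limit:
  "(\<lambda>m. \<Sum>i. \<Sum>j. \<Sum>k. ie_term m i j k) \<longlonglongrightarrow> exp (- 3 / 4)"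
proof -
  have "summable (\<lambda>k. 1 / fact k :: real)"
    using summable_exp[of "1::real"] by (simp add: divide_inverse)
  moreover have "(\<lambda>k. (-1/4) ^ k / fact k) sums exp (-1/4 :: real)"
    using exp_converges[of "-1/4 :: real"]
    by (simp only: real_scaleR_def divide_inverse[of _ "fact _"] mult.commute)
  ultimately have "(\<lambda>m. \<Sum>i. \<Sum>j. \<Sum>k. ie_term m i j k)
      \<longlonglongrightarrow> exp (-1/4) * exp (-1/4) * exp (-1/4)"
    by (rule suminf_triple_limit[OF ie_term_limit abs_ie_term_le])
  then show ?thesis by (simp flip: exp_add)
qed

text \<open>The terms vanish once an index exceeds \<open>m\<close>, so the finite sums extend to
  series whose range does not depend on \<open>m\<close>, as dominated convergence needs.\<close>

lemma pm_ratio_eq: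
  assumes "perfect_matching (complete_tripartite (2*m) (2*m) (2*m)) M"
  shows "real (pm (delete_edges (complete_tripartite (2*m) (2*m) (2*m)) M))
      / real (pm (complete_tripartite (2*m) (2*m) (2*m))) = (\<Sum>i. \<Sum>j. \<Sum>k. ie_term m i j k)"
proof -
  have "real (pm (delete_edges (complete_tripartite (2*m) (2*m) (2*m)) M))
      / real (pm (complete_tripartite (2*m) (2*m) (2*m)))
      = (\<Sum>i\<le>m. \<Sum>j\<le>m. \<Sum>k\<le>m. ie_term m i j k)"
    unfolding pm_delete_edges[OF assms] pm_complete_tripartite sum_divide_distrib
    by (intro sum.cong refl ie_term_eq) auto
  also have "\<dots> = (\<Sum>i. \<Sum>j. \<Sum>k. ie_term m i j k)"
  proof -
    have k: "(\<Sum>k. ie_term m i j k) = (\<Sum>k\<le>m. ie_term m i j k)" for i j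
      by (intro suminf_finite) (auto intro: ie_term_eq_0)
    have j: "(\<Sum>j. \<Sum>k\<le>m. ie_term m i j k) = (\<Sum>j\<le>m. \<Sum>k\<le>m. ie_term m i j k)" for i
      by (intro suminf_finite) (auto intro!: sum.neutral ie_term_eq_0)
    have i: "(\<Sum>i. \<Sum>j\<le>m. \<Sum>k\<le>m. ie_term m i j k) = (\<Sum>i\<le>m. \<Sum>j\<le>m. \<Sum>k\<le>m. ie_term m i j k)"
      by (intro suminf_finite) (auto intro!: sum.neutral ie_term_eq_0)
    show ?thesis by (simp only: k j i)
  qed
  finally show ?thesis .
qed

theorem theorem5:
  fixes M :: "nat \<Rightarrow> (nat \<times> nat) set set"
  assumes "\<And>m. m \<ge> 1 \<Longrightarrow> perfect_matching (complete_tripartite (2*m) (2*m) (2*m)) (M m)"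
  shows "(\<lambda>m. real (pm (delete_edges (complete_tripartite (2*m) (2*m) (2*m)) (M m)))
              / real (pm (complete_tripartite (2*m) (2*m) (2*m))))
         \<longlonglongrightarrow> exp (- 3 / 4)"
proof (rule Lim_transform_eventually[OF ie_sum_limit])
  show "\<forall>\<^sub>F m in sequentially. (\<Sum>i. \<Sum>j. \<Sum>k. ie_term m i j k)
      = real (pm (delete_edges (complete_tripartite (2*m) (2*m) (2*m)) (M m)))
        / real (pm (complete_tripartite (2*m) (2*m) (2*m)))"
    \<comment> \<open>For \<open>m = 0\<close> nothing is assumed about \<open>M m\<close>, so the
      identity is claimed only eventually.\<close>
    using eventually_ge_at_top[of 1] by eventually_elim (simp add: pm_ratio_eq assms)
qed

end
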